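(* Let $L\ge 0$ be an integer, let $\alpha>0$, and let $g\in\mathcal G_L$. Then $$\mathbb E_{\mathrm{Plan}}^{\alpha}[g]=\lim_{M\to\infty}\mathbb E_{\mathrm{Ch},M}^{\alpha}[g],$$ where $\mathbb E_{\mathrm{Plan}}^{\alpha}$ is expectation with respect to the Poissonized Plancherel measure with parameter $\alpha$ and $\mathbb E_{\mathrm{Ch},M}^{\alpha}$ is expectation with respect to the Charlier ensemble on $\Omega_M$ with parameter $\alpha$.
   Context: $\mathbb N=\{0,1,2,\dots\}$. $\mathcal P$ is the set of all partitions $\lambda=(\lambda_1\ge\lambda_2\ge\dots)$, $\lambda_i\in\mathbb N$, $\sum_j\lambda_j<\infty$; $\mathcal P^{(N)}$ is the set of partitions with $\sum_j\lambda_j=N$. $f^\lambda$ is the number of standard Young tableaux of shape $\lambda$. Plancherel measure: $\mathbb P_{\mathrm{Plan},N}[\{\lambda\}]=(f^\lambda)^2/N!$ for $\lambda\in\mathcal P^{(N)}$ (and $0$ otherwise). Poissonized Plancherel measure on $\mathcal P$: $\mathbb P_{\mathrm{Plan}}^\alpha[\{\lambda\}]=e^{-\alpha}\sum_{N=0}^\infty \mathbb P_{\mathrm{Plan},N}[\{\lambda\}]\frac{\alpha^N}{N!}$. The class $\mathcal G_L$: let $f:\mathbb Z\to\mathbb C$ be bounded with $f(n)=1$ for $n<0$. The function $g:\mathcal P\to\mathbb C$ generated by $f$ (for the given integer $L\ge0$) is $g(\lambda)=\prod_{i=1}^\infty f(\lambda_i+L-i)$. $\mathcal G_L$ is the set of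 all such $g$. $\Omega_M=\{\lambda\in\mathbb N^M:\lambda_1\ge\dots\ge\lambda_M\}$, identified with the partitions having at most $M$ nonzero parts; for $M\ge L$ and $\lambda\in\Omega_M$, $g(\lambda)=\prod_{i=1}^M f(\lambda_i+L-i)$. $V_M(\lambda)=\prod_{1\le i<j\le M}(\lambda_i-\lambda_j+j-i)$, $W_M(\lambda)=\prod_{i=1}^M\frac1{(\lambda_i+M-i)!}$. The Charlier ensemble is the probability measure on $\Omega_M$ $$\mathbb P_{\mathrm{Ch},M}^\alpha[\{\lambda\}]=\Bigl(\prod_{j=1}^{M-1}\frac1{j!}\Bigr)V_M(\lambda)^2W_M(\lambda)\prod_{i=1}^M\Bigl[\Bigl(\frac{\alpha}{M}\Bigr)^{\lambda_i}e^{-\alpha/M}\Bigr].$$ *)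

theory Defs
  imports "HOL-Analysis.Analysis"
begin

(* A partition is a weakly decreasing, finitely supported sequence, indexed from 0:
   p i is the part usually written lambda_(i+1).  This shifts every formula below by one. *)
definition partitions :: "(nat \<Rightarrow> nat) set" where
  "partitions = {p. antimono p \<and> finite {i. p i \<noteq> 0}}"

definition psize :: "(nat \<Rightarrow> nat) \<Rightarrow> nat" where
  "psize p = (\<Sum>i | p i \<noteq> 0. p i)"

definition partitions_of :: "nat \<Rightarrow> (nat \<Rightarrow> nat) set" where
  "partitions_of N = {p \<in> partitions. psize p = N}"

definition diagram :: "(nat \<Rightarrow> nat) \<Rightarrow> (nat \<times> nat) set" where
  "diagram p = {(i, j). j < p i}"

(* Fillings are extensional (undefined outside the diagram) so that each one is counted once. *)
definition standard_tableaux :: "(nat \<Rightarrow> nat) \<Rightarrow> (nat \<times> nat \<Rightarrow> nat) set" where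
  "standard_tableaux p =
     {T \<in> extensional (diagram p).
        bij_betw T (diagram p) {1..psize p} \<and>
        (\<forall>i j j'. (i, j) \<in> diagram p \<and> (i, j') \<in> diagram p \<and> j < j' \<longrightarrow> T (i, j) < T (i, j')) \<and>
        (\<forall>i i' j. (i, j) \<in> diagram p \<and> (i', j) \<in> diagram p \<and> i < i' \<longrightarrow> T (i, j) < T (i', j))}"

definition num_syt :: "(nat \<Rightarrow> nat) \<Rightarrow> nat" where
  "num_syt p = card (standard_tableaux p)"

definition plancherel_mass :: "nat \<Rightarrow> (nat \<Rightarrow> nat) \<Rightarrow> real" where
  "plancherel_mass N p = (if p \<in> partitions_of N then (real (num_syt p))\<^sup>2 / fact N else 0)"

definition poissonized_plancherel_mass :: "real \<Rightarrow> (nat \<Rightarrow> nat) \<Rightarrow> real" where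
  "poissonized_plancherel_mass \<alpha> p =
     exp (- \<alpha>) * (\<Sum>N. plancherel_mass N p * (\<alpha> ^ N / fact N))"

definition poissonized_plancherel :: "real \<Rightarrow> (nat \<Rightarrow> nat) measure" where
  "poissonized_plancherel \<alpha> =
     point_measure partitions (\<lambda>p. ennreal (poissonized_plancherel_mass \<alpha> p))"

(* The infinite product has only finitely many factors different from 1.
   Values of g off the set of partitions are left unconstrained. *)
definition \<G> :: "nat \<Rightarrow> ((nat \<Rightarrow> nat) \<Rightarrow> complex) set" where
  "\<G> L = {g. \<exists>f :: int \<Rightarrow> complex. bounded (range f) \<and> (\<forall>n<0. f n = 1) \<and>
            (\<forall>p\<in>partitions. g p = (\<Prod>i. f (int (p i) + int L - int (Suc i))))}"

(* The weakly decreasing M-tuples, as partitions with at most M nonzero parts. *)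
definition \<Omega> :: "nat \<Rightarrow> (nat \<Rightarrow> nat) set" where
  "\<Omega> M = {p \<in> partitions. \<forall>i\<ge>M. p i = 0}"

definition V :: "nat \<Rightarrow> (nat \<Rightarrow> nat) \<Rightarrow> real" where
  "V M p = (\<Prod>(i, j) \<in> {(i, j). i < j \<and> j < M}. real (p i) - real (p j) + real j - real i)"

definition W :: "nat \<Rightarrow> (nat \<Rightarrow> nat) \<Rightarrow> real" where
  "W M p = (\<Prod>i<M. 1 / fact (p i + (M - Suc i)))"

definition charlier_mass :: "real \<Rightarrow> nat \<Rightarrow> (nat \<Rightarrow> nat) \<Rightarrow> real" where
  "charlier_mass \<alpha> M p =
     (\<Prod>j = 1..M - 1. 1 / fact j) * (V M p)\<^sup>2 * W M p *
     (\<Prod>i<M. (\<alpha> / real M) ^ p i * exp (- \<alpha> / real M))"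

definition charlier :: "real \<Rightarrow> nat \<Rightarrow> (nat \<Rightarrow> nat) measure" where
  "charlier \<alpha> M = point_measure (\<Omega> M) (\<lambda>p. ennreal (charlier_mass \<alpha> M p))"

end

(* Write F p = num_syt p / |p|!.  Removing the largest entry of a tableau gives the recursion
   |p| F p = sum of F (p - e_i) over the corners i of p, from which Frobenius' formula F = V_M W_M
   on Omega_M follows by a partial fraction identity.  Hence the Charlier mass of p is the
   Poissonized Plancherel mass times prod (1 + (j - i) / M), taken over the boxes (i, j) of p,
   and this factor tends to 1.
   For domination let R = prod (j + 1) and C = prod (i + 1) over the boxes.  The correction
   factor is at most R, and the recursion gives F R <= 1 and F C <= 1.  Since R C grows
   superexponentially in |p|, the bound F^2 R <= min (1/R) (1/C) beats the exponential growth of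
   alpha^|p|, of |g| and of the number of partitions (at most 4^|p|), so dominated convergence
   applies. *)
theory Submission
  imports Defs
begin

section \<open>Partial fractions and the sums derived from them\<close>

text \<open>As a rational function of \<open>y\<close> the left side tends to 1 at infinity and has
  simple poles at the \<open>x i\<close>, with residue \<open>-t\<close> times the product over the
  other nodes. Adding one node at a time gives a purely algebraic proof over any field.\<close>

lemma partial_fraction_shift:
  fixes x :: "'a \<Rightarrow> 'b :: field"
  assumes "finite I" "inj_on x I" "y \<notin> x ` I"
  shows "(\<Prod>j\<in>I. 1 - t / (y - x j)) =
         1 - t * (\<Sum>i\<in>I. (\<Prod>j\<in>I - {i}. 1 - t / (x i - x j)) / (y - x i))"
  using assms
proof (induction I arbitrary: y rule: finite_induct)
  case empty
  then show ?case by simp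
next
  case (insert k I)
  define r where "r i = (\<Prod>j\<in>I - {i}. 1 - t / (x i - x j))" for i
  have kI: "x k \<notin> x ` I" and inj: "inj_on x I"
    using insert by (auto simp: inj_on_def)
  have y: "y \<notin> x ` I" "y \<noteq> x k" using insert by auto
  have IH: "(\<Prod>j\<in>I. 1 - t / (z - x j)) = 1 - t * (\<Sum>i\<in>I. r i / (z - x i))"
    if "z \<notin> x ` I" for z
    using insert.IH[OF inj that] by (simp add: r_def)
  have new: "(\<Prod>j\<in>insert k I - {i}. 1 - t / (x i - x j)) = r i * (1 - t / (x i - x k))"
    if "i \<in> I" for i
  proof -
    have "insert k I - {i} = insert k (I - {i})" using that insert by auto
    then show ?thesis using insert by (simp add: r_def)
  qed
  have "insert k I - {k} = I" using insert by auto
  then have newk: "(\<Prod>j\<in>insert k I - {k}. 1 - t / (x k - x j)) = 1 - t * (\<Sum>i\<in>I. r i / (x k - x i))"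
    using IH[OF kI] by simp
  have key: "r i / (y - x i) * (1 / (y - x k)) =
      - (r i / ((x k - x i) * (y - x i))) + r i / (x k - x i) / (y - x k)" if "i \<in> I" for i
  proof -
    have "y - x i \<noteq> 0" "x k - x i \<noteq> 0" "y - x k \<noteq> 0" using that y kI by auto
    then show ?thesis by (simp add: divide_simps) (simp add: algebra_simps)
  qed
  have "(\<Sum>i\<in>insert k I. (\<Prod>j\<in>insert k I - {i}. 1 - t / (x i - x j)) / (y - x i)) =
        (1 - t * (\<Sum>i\<in>I. r i / (x k - x i))) / (y - x k) +
        (\<Sum>i\<in>I. r i * (1 - t / (x i - x k)) / (y - x i))"
    using insert newk new by simp
  also have "(\<Sum>i\<in>I. r i * (1 - t / (x i - x k)) / (y - x i)) =
      (\<Sum>i\<in>I. r i / (y - x i) + t * (r i / ((x k - x i) * (y - x i))))"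
  proof (rule sum.cong)
    fix i assume "i \<in> I"
    then have "y - x i \<noteq> 0" "x k - x i \<noteq> 0" "x i - x k \<noteq> 0" using y kI by (auto simp: image_iff)
    then show "r i * (1 - t / (x i - x k)) / (y - x i) =
        r i / (y - x i) + t * (r i / ((x k - x i) * (y - x i)))"
      by (simp add: divide_simps) (simp add: algebra_simps)
  qed simp
  also have "\<dots> = (\<Sum>i\<in>I. r i / (y - x i)) + t * (\<Sum>i\<in>I. r i / ((x k - x i) * (y - x i)))"
    by (simp add: sum.distrib sum_distrib_left)
  finally have S: "(\<Sum>i\<in>insert k I. (\<Prod>j\<in>insert k I - {i}. 1 - t / (x i - x j)) / (y - x i)) =
    (1 - t * (\<Sum>i\<in>I. r i / (x k - x i))) / (y - x k) +
    ((\<Sum>i\<in>I. r i / (y - x i)) + t * (\<Sum>i\<in>I. r i / ((x k - x i) * (y - x i))))" .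
  have "(\<Sum>i\<in>I. r i / (y - x i)) * (1 / (y - x k)) =
      - (\<Sum>i\<in>I. r i / ((x k - x i) * (y - x i))) + (\<Sum>i\<in>I. r i / (x k - x i)) / (y - x k)"
    unfolding sum_distrib_right sum_divide_distrib sum_negf[symmetric] sum.distrib[symmetric]
    by (rule sum.cong[OF refl key])
  then have "(\<Sum>i\<in>I. r i / ((x k - x i) * (y - x i))) =
      (\<Sum>i\<in>I. r i / (x k - x i)) / (y - x k) - (\<Sum>i\<in>I. r i / (y - x i)) * (1 / (y - x k))"
    by (simp only: diff_conv_add_uminus add.commute minus_add_cancel minus_minus eq_diff_eq) simp
  then have K: "t * (\<Sum>i\<in>I. r i / ((x k - x i) * (y - x i))) =
      t * ((\<Sum>i\<in>I. r i / (x k - x i)) / (y - x k)) - t * ((\<Sum>i\<in>I. r i / (y - x i)) * (1 / (y - x k)))"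
    by (simp only: right_diff_distrib)
  \<comment> \<open>Here \<open>d\<close> is \<open>y - x k\<close>, and \<open>a\<close> and
    \<open>b\<close> are the sums of \<open>r i / (y - x i)\<close> and of
    \<open>r i / (x k - x i)\<close>.\<close>
  have alg: "(1 - t / d) * (1 - t * a) = 1 - t * ((1 - t * b) / d + (a + (t * (b / d) - t * (a * (1 / d)))))"
    for a b d :: 'b by (simp add: divide_inverse algebra_simps)
  show ?case
    unfolding S K prod.insert[OF insert.hyps(1,2)] IH[OF y(1)] by (rule alg)
qed

text \<open>These compare the coefficients of \<open>1/y\<close> and \<open>1/y^2\<close> in the
  expansion of \<open>partial_fraction_shift\<close> at infinity; the proof is again by induction on
  the nodes. The second sum is the one that Frobenius' formula needs.\<close>

lemma sum_shift_products:
  fixes x :: "'a \<Rightarrow> 'b :: field_char_0"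
  assumes "finite I" "inj_on x I"
  shows "(\<Sum>i\<in>I. \<Prod>j\<in>I - {i}. 1 - t / (x i - x j)) = of_nat (card I)"
    and "(\<Sum>i\<in>I. x i * (\<Prod>j\<in>I - {i}. 1 - t / (x i - x j))) =
         (\<Sum>i\<in>I. x i) - t * of_nat (card I choose 2)"
proof -
  have "(\<Sum>i\<in>I. \<Prod>j\<in>I - {i}. 1 - t / (x i - x j)) = of_nat (card I) \<and>
    (\<Sum>i\<in>I. x i * (\<Prod>j\<in>I - {i}. 1 - t / (x i - x j))) =
         (\<Sum>i\<in>I. x i) - t * of_nat (card I choose 2)"
    using assms
  proof (induction I rule: finite_induct)
    case empty
    then show ?case by simp
  next
    case (insert k I)
    define r where "r i = (\<Prod>j\<in>I - {i}. 1 - t / (x i - x j))" for i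
    have kI: "x k \<notin> x ` I" and inj: "inj_on x I"
      using insert by (auto simp: inj_on_def)
    have IH: "(\<Sum>i\<in>I. r i) = of_nat (card I)"
        "(\<Sum>i\<in>I. x i * r i) = (\<Sum>i\<in>I. x i) - t * of_nat (card I choose 2)"
      using insert.IH[OF inj] by (simp_all add: r_def)
    have new: "(\<Prod>j\<in>insert k I - {i}. 1 - t / (x i - x j)) = r i + t * (r i / (x k - x i))"
      if "i \<in> I" for i
    proof -
      have e: "insert k I - {i} = insert k (I - {i})" using that insert by auto
      have "x i \<noteq> x k" using that kI by (auto simp: image_iff)
      then have "(1 - t / (x i - x k)) = 1 + t / (x k - x i)"
        by (simp add: divide_simps) (simp add: algebra_simps)
      moreover have "(\<Prod>j\<in>insert k I - {i}. 1 - t / (x i - x j)) = (1 - t / (x i - x k)) * r i"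
        unfolding e using insert by (simp add: r_def)
      ultimately show ?thesis by (simp only: distrib_right) simp
    qed
    have "insert k I - {k} = I" using insert by auto
    \<comment> \<open>The product at the new node is expanded by partial fractions at
      \<open>y = x k\<close>; its correction terms cancel against those that \<open>new\<close> adds
      at the old nodes.\<close>
    then have newk: "(\<Prod>j\<in>insert k I - {k}. 1 - t / (x k - x j)) = 1 - t * (\<Sum>i\<in>I. r i / (x k - x i))"
      using partial_fraction_shift[OF \<open>finite I\<close> inj kI] by (simp add: r_def)
    have "(\<Sum>i\<in>insert k I. \<Prod>j\<in>insert k I - {i}. 1 - t / (x i - x j)) =
        (1 - t * (\<Sum>i\<in>I. r i / (x k - x i))) + (\<Sum>i\<in>I. r i + t * (r i / (x k - x i)))"
      using insert newk new by simp
    also have "\<dots> = of_nat (card (insert k I))"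
      using insert by (simp add: sum.distrib sum_distrib_left IH)
    finally have 1: "(\<Sum>i\<in>insert k I. \<Prod>j\<in>insert k I - {i}. 1 - t / (x i - x j)) =
        of_nat (card (insert k I))" .
    have "(\<Sum>i\<in>insert k I. x i * (\<Prod>j\<in>insert k I - {i}. 1 - t / (x i - x j))) =
        x k * (1 - t * (\<Sum>i\<in>I. r i / (x k - x i))) + (\<Sum>i\<in>I. x i * (r i + t * (r i / (x k - x i))))"
      using insert newk new by simp
    also have "(\<Sum>i\<in>I. x i * (r i + t * (r i / (x k - x i)))) =
       (\<Sum>i\<in>I. x i * r i - t * r i + t * x k * (r i / (x k - x i)))"
    proof (rule sum.cong)
      fix i assume "i \<in> I"
      then have "x k - x i \<noteq> 0" using kI by auto
      then show "x i * (r i + t * (r i / (x k - x i))) = x i * r i - t * r i + t * x k * (r i / (x k - x i))"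
        by (simp add: field_simps)
    qed simp
    also have "\<dots> = (\<Sum>i\<in>I. x i * r i) - t * (\<Sum>i\<in>I. r i) + t * x k * (\<Sum>i\<in>I. r i / (x k - x i))"
      by (simp add: sum.distrib sum_distrib_left sum_subtractf)
    finally have 2: "(\<Sum>i\<in>insert k I. x i * (\<Prod>j\<in>insert k I - {i}. 1 - t / (x i - x j))) =
        (\<Sum>i\<in>insert k I. x i) - t * of_nat (card (insert k I) choose 2)"
      using insert unfolding IH by (simp add: algebra_simps numeral_2_eq_2)
    show ?case using 1 2 by blast
  qed
  then show "(\<Sum>i\<in>I. \<Prod>j\<in>I - {i}. 1 - t / (x i - x j)) = of_nat (card I)"
    and "(\<Sum>i\<in>I. x i * (\<Prod>j\<in>I - {i}. 1 - t / (x i - x j))) =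
         (\<Sum>i\<in>I. x i) - t * of_nat (card I choose 2)" by auto
qed

section \<open>Partitions and the removal of corner boxes\<close>

lemma partitions_antimonoD: "p \<in> partitions \<Longrightarrow> i \<le> j \<Longrightarrow> p j \<le> p i"
  by (auto simp: partitions_def antimono_def)

lemma psize_eq_sum: "p \<in> \<Omega> M \<Longrightarrow> psize p = (\<Sum>i<M. p i)"
  unfolding psize_def
  by (rule sum.mono_neutral_left) (auto simp: \<Omega>_def not_less[symmetric])

text \<open>A nonzero part in row \<open>i\<close> forces at least one box in each of the rows
  \<open>0, ..., i\<close>.\<close>

lemma partition_supported_below_size:
  assumes p: "p \<in> partitions" and nz: "p i \<noteq> 0"
  shows "i < psize p"
proof -
  have "Suc i = (\<Sum>k\<le>i. 1)" by simp
  also have "\<dots> \<le> (\<Sum>k\<le>i. p k)"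
    using partitions_antimonoD[OF p] nz by (intro sum_mono) (fastforce simp: Suc_le_eq)
  also have "\<dots> \<le> psize p"
    unfolding psize_def using p nz partitions_antimonoD[OF p]
    by (intro sum_mono2) (fastforce simp: partitions_def)+
  finally show ?thesis by simp
qed

lemma partition_in_Omega: "p \<in> partitions \<Longrightarrow> psize p \<le> M \<Longrightarrow> p \<in> \<Omega> M"
  using partition_supported_below_size by (fastforce simp: \<Omega>_def)

text \<open>A corner is recorded by its row alone; the removable box is
  \<open>(i, p i - 1)\<close>.\<close>

definition corners :: "(nat \<Rightarrow> nat) \<Rightarrow> nat set" where
  "corners p = {i. p (Suc i) < p i}"

definition remove_box :: "(nat \<Rightarrow> nat) \<Rightarrow> nat \<Rightarrow> (nat \<Rightarrow> nat)" where
  "remove_box p i = p(i := p i - 1)"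

lemma corner_pos: "i \<in> corners p \<Longrightarrow> 0 < p i"
  by (auto simp: corners_def)

lemma corners_subset: "p \<in> \<Omega> M \<Longrightarrow> corners p \<subseteq> {..<M}"
  by (auto simp: corners_def \<Omega>_def not_less[symmetric])

lemma remove_box_Omega:
  assumes p: "p \<in> \<Omega> M" and i: "i \<in> corners p"
  shows "remove_box p i \<in> \<Omega> M"
proof -
  have P: "p \<in> partitions" using p by (simp add: \<Omega>_def)
  have "remove_box p i b \<le> remove_box p i a" if "a \<le> b" for a b
  \<comment> \<open>Lowering row \<open>i\<close> can break monotonicity only against a later row,
    and there the strict drop after a corner leaves room.\<close>
  proof (cases "a = i \<and> b \<noteq> i")
    case True
    then have "p b \<le> p (Suc i)" using that partitions_antimonoD[OF P, of "Suc i" b] by simp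
    then show ?thesis using True i by (auto simp: remove_box_def corners_def)
  next
    case False
    then show ?thesis using that partitions_antimonoD[OF P, of a b] by (auto simp: remove_box_def)
  qed
  moreover have "{k. remove_box p i k \<noteq> 0} \<subseteq> {k. p k \<noteq> 0}" by (auto simp: remove_box_def)
  then have "finite {k. remove_box p i k \<noteq> 0}"
    by (rule finite_subset) (use P in \<open>simp add: partitions_def\<close>)
  ultimately show ?thesis using p i
    by (auto simp: \<Omega>_def partitions_def antimono_def remove_box_def corners_def)
qed

lemma remove_box_partitions:
  "p \<in> partitions \<Longrightarrow> i \<in> corners p \<Longrightarrow> remove_box p i \<in> partitions"
  using remove_box_Omega[OF partition_in_Omega] by (auto simp: \<Omega>_def)

lemma psize_remove_box:
  assumes p: "p \<in> partitions" and i: "i \<in> corners p"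
  shows "psize p = Suc (psize (remove_box p i))"
proof -
  define M where "M = psize p"
  have pM: "p \<in> \<Omega> M" using partition_in_Omega[OF p] by (simp add: M_def)
  have iM: "i < M" using corners_subset[OF pM] i by auto
  have "(\<Sum>k<M. p k) = p i + (\<Sum>k\<in>{..<M}-{i}. p k)"
    using iM by (simp add: sum.remove)
  moreover have "(\<Sum>k<M. remove_box p i k) = (p i - 1) + (\<Sum>k\<in>{..<M}-{i}. p k)"
    using iM by (simp add: sum.remove remove_box_def)
  ultimately show ?thesis
    using psize_eq_sum[OF pM] psize_eq_sum[OF remove_box_Omega[OF pM i]] corner_pos[OF i] by simp
qed

lemma diagram_remove_box:
  assumes "i \<in> corners p"
  shows "diagram p = insert (i, p i - 1) (diagram (remove_box p i))"
    "(i, p i - 1) \<notin> diagram (remove_box p i)"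
  using corner_pos[OF assms] by (auto simp: diagram_def remove_box_def split: if_splits)

section \<open>The recursion for the number of standard tableaux\<close>

lemma finite_standard_tableaux:
  assumes p: "p \<in> partitions"
  shows "finite (standard_tableaux p)"
proof -
  have "diagram p \<subseteq> {..<psize p} \<times> {..p 0}"
    using partition_supported_below_size[OF p] partitions_antimonoD[OF p, of 0]
    by (auto simp: diagram_def) (meson less_imp_le_nat le_trans)
  then have "finite (diagram p)" by (rule finite_subset) simp
  moreover have "standard_tableaux p \<subseteq> PiE (diagram p) (\<lambda>_. {1..psize p})"
    by (auto simp: standard_tableaux_def PiE_def bij_betw_def)
  ultimately show ?thesis using finite_PiE by (metis finite_atLeastAtMost finite_subset)
qed

text \<open>The new entry exceeds all others and no box lies to its right or below it, so it only
  ever occurs as the larger side of an order condition.\<close>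

lemma standard_tableaux_add_box:
  assumes p: "p \<in> partitions" and i: "i \<in> corners p"
    and T: "T \<in> standard_tableaux (remove_box p i)"
  shows "T((i, p i - 1) := psize p) \<in> standard_tableaux p"
proof -
  let ?c = "(i, p i - 1)" and ?q = "remove_box p i" and ?N = "psize p"
  note D = diagram_remove_box[OF i] and N = psize_remove_box[OF p i]
  have bij: "bij_betw T (diagram ?q) {1..psize ?q}" and ext: "T \<in> extensional (diagram ?q)"
    and row: "\<And>i j j'. (i, j) \<in> diagram ?q \<Longrightarrow> (i, j') \<in> diagram ?q \<Longrightarrow> j < j' \<Longrightarrow> T (i, j) < T (i, j')"
    and col: "\<And>i i' j. (i, j) \<in> diagram ?q \<Longrightarrow> (i', j) \<in> diagram ?q \<Longrightarrow> i < i' \<Longrightarrow> T (i, j) < T (i', j)"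
    using T unfolding standard_tableaux_def by blast+
  have small: "T b < ?N" if "b \<in> diagram ?q" for b
    using bij_betw_apply[OF bij that] N by auto
  have "bij_betw (T(?c := ?N)) (diagram ?q) {1..psize ?q}"
    using bij D(2) by (subst bij_betw_cong[where g = T]) auto
  moreover have "?N \<notin> {1..psize ?q}" using N by simp
  ultimately have "bij_betw (T(?c := ?N)) (insert ?c (diagram ?q)) (insert ?N {1..psize ?q})"
    using D(2) notIn_Un_bij_betw[of ?c "diagram ?q" "T(?c := ?N)" "{1..psize ?q}"] by simp
  moreover have "insert ?N {1..psize ?q} = {1..?N}" using N by auto
  ultimately have "bij_betw (T(?c := ?N)) (diagram p) {1..?N}" using D(1) by simp
  moreover have "(T(?c := ?N)) (a, j) < (T(?c := ?N)) (a, j')"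
    if "(a, j) \<in> diagram p" "(a, j') \<in> diagram p" "j < j'" for a j j'
  proof -
    have "(a, j) \<noteq> ?c" using that by (auto simp: diagram_def)
    then show ?thesis using that row[of a j j'] small[of "(a, j)"] D(1) by auto
  qed
  moreover have "(T(?c := ?N)) (a, j) < (T(?c := ?N)) (a', j)"
    if "(a, j) \<in> diagram p" "(a', j) \<in> diagram p" "a < a'" for a a' j
  proof -
    have "(a, j) \<noteq> ?c"
      using that i partitions_antimonoD[OF p, of "Suc i" a'] by (auto simp: diagram_def corners_def)
    then show ?thesis using that col[of a j a'] small[of "(a, j)"] D(1) by auto
  qed
  ultimately show ?thesis
    using ext D(1) unfolding standard_tableaux_def by (auto simp: extensional_def)
qed

text \<open>A box to the right of the largest entry or below it would need a still larger entry, so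
  the largest entry occupies a corner and can be erased.\<close>

lemma standard_tableaux_cases:
  assumes p: "p \<in> partitions" and N: "psize p > 0" and T: "T \<in> standard_tableaux p"
  obtains i T' where "i \<in> corners p" "T' \<in> standard_tableaux (remove_box p i)"
    "T = T'((i, p i - 1) := psize p)"
proof -
  have bij: "bij_betw T (diagram p) {1..psize p}" and ext: "T \<in> extensional (diagram p)"
    and row: "\<And>i j j'. (i, j) \<in> diagram p \<Longrightarrow> (i, j') \<in> diagram p \<Longrightarrow> j < j' \<Longrightarrow> T (i, j) < T (i, j')"
    and col: "\<And>i i' j. (i, j) \<in> diagram p \<Longrightarrow> (i', j) \<in> diagram p \<Longrightarrow> i < i' \<Longrightarrow> T (i, j) < T (i', j)"
    using T unfolding standard_tableaux_def by blast+
  have le: "T b \<le> psize p" if "b \<in> diagram p" for b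
    using bij_betw_apply[OF bij that] by auto
  have "psize p \<in> T ` diagram p" using bij N by (simp add: bij_betw_def)
  then obtain i j where ij: "(i, j) \<in> diagram p" "T (i, j) = psize p" by auto
  have "\<not> Suc j < p i"
    using row[of i j "Suc j"] le[of "(i, Suc j)"] ij by (auto simp: diagram_def)
  then have j: "j = p i - 1" using ij by (auto simp: diagram_def)
  have "\<not> j < p (Suc i)"
    using col[of i j "Suc i"] le[of "(Suc i, j)"] ij by (auto simp: diagram_def)
  then have i: "i \<in> corners p" using ij by (auto simp: diagram_def corners_def)
  note D = diagram_remove_box[OF i] and Nq = psize_remove_box[OF p i]
  let ?c = "(i, p i - 1)" and ?q = "remove_box p i"
  \<comment> \<open>The erased box must take the value \<open>undefined\<close> for
    \<open>T'\<close> to be extensional on the smaller diagram.\<close>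
  define T' where "T' = T(?c := undefined)"
  have eq: "T' b = T b" if "b \<in> diagram ?q" for b using that D(2) by (auto simp: T'_def)
  have inj: "inj_on T (diagram p)" using bij by (simp add: bij_betw_def)
  have "T ` diagram ?q = T ` (diagram p - {?c})" using D by auto
  also have "\<dots> = T ` diagram p - T ` {?c}"
    using D by (intro inj_on_image_set_diff[OF inj]) auto
  also have "\<dots> = {1..psize ?q}" using bij ij j Nq by (auto simp: bij_betw_def)
  finally have "bij_betw T (diagram ?q) {1..psize ?q}"
    using inj D(1) by (auto simp: bij_betw_def inj_on_def)
  then have "bij_betw T' (diagram ?q) {1..psize ?q}"
    using eq by (subst bij_betw_cong) auto
  moreover have "T' \<in> extensional (diagram ?q)"
    using ext D(1) by (auto simp: T'_def extensional_def)
  moreover have "T' (a, b) < T' (a, b')"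
    if "(a, b) \<in> diagram ?q" "(a, b') \<in> diagram ?q" "b < b'" for a b b'
    using row[of a b b'] that eq D(1) by auto
  moreover have "T' (a, b) < T' (a', b)"
    if "(a, b) \<in> diagram ?q" "(a', b) \<in> diagram ?q" "a < a'" for a a' b
    using col[of a b a'] that eq D(1) by auto
  ultimately have "T' \<in> standard_tableaux ?q" unfolding standard_tableaux_def by blast
  moreover have "T = T'(?c := psize p)" using ij j by (auto simp: T'_def)
  ultimately show ?thesis using that i by blast
qed

text \<open>The tableaux are sorted by the corner that holds the largest entry.\<close>

lemma num_syt_rec:
  assumes p: "p \<in> partitions" and N: "psize p > 0"
  shows "num_syt p = (\<Sum>i\<in>corners p. num_syt (remove_box p i))"
proof -
  define A where "A i = (\<lambda>T. T((i, p i - 1) := psize p)) ` standard_tableaux (remove_box p i)" for i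
  have fin: "finite (corners p)"
    using corners_subset[OF partition_in_Omega[OF p order_refl]] by (rule finite_subset) simp
  have small: "T b < psize p"
    if "i \<in> corners p" "T \<in> standard_tableaux (remove_box p i)" "b \<in> diagram (remove_box p i)" for i T b
    using that bij_betw_apply[of T "diagram (remove_box p i)" "{1..psize (remove_box p i)}" b]
      psize_remove_box[OF p that(1)] by (auto simp: standard_tableaux_def)
  have undef: "T (i, p i - 1) = undefined"
    if "i \<in> corners p" "T \<in> standard_tableaux (remove_box p i)" for i T
    using that diagram_remove_box(2)[OF that(1)] by (auto simp: standard_tableaux_def extensional_def)
  have "standard_tableaux p = (\<Union>i\<in>corners p. A i)"
    using standard_tableaux_add_box[OF p] standard_tableaux_cases[OF p N]
    by (auto simp: A_def) blast
  moreover have "card (\<Union>i\<in>corners p. A i) = (\<Sum>i\<in>corners p. card (A i))"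
  proof (rule card_UN_disjoint)
    show "\<forall>i\<in>corners p. finite (A i)"
      using finite_standard_tableaux remove_box_partitions[OF p] by (auto simp: A_def)
    \<comment> \<open>If the two extended fillings agreed, the box of corner \<open>i\<close> would
      hold \<open>psize p\<close> on one side and an entry of \<open>T\<close>, which is smaller, on
      the other.\<close>
    have False if i: "i \<in> corners p" and k: "k \<in> corners p" and "i \<noteq> k"
      and S: "S \<in> standard_tableaux (remove_box p i)" and T: "T \<in> standard_tableaux (remove_box p k)"
      and eq: "S((i, p i - 1) := psize p) = T((k, p k - 1) := psize p)" for i k S T
    proof -
      have "(i, p i - 1) \<in> diagram (remove_box p k)"
        using corner_pos[OF i] \<open>i \<noteq> k\<close> by (simp add: diagram_def remove_box_def)
      then show False using small[OF k T] fun_cong[OF eq, of "(i, p i - 1)"] \<open>i \<noteq> k\<close> by auto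
    qed
    then show "\<forall>i\<in>corners p. \<forall>j\<in>corners p. i \<noteq> j \<longrightarrow> A i \<inter> A j = {}"
      unfolding A_def by blast
  qed (rule fin)
  moreover have "card (A i) = num_syt (remove_box p i)" if i: "i \<in> corners p" for i
  proof -
    \<comment> \<open>All tableaux of the smaller shape are \<open>undefined\<close> at the removed
      box, so overwriting it loses no information.\<close>
    have "inj_on (\<lambda>T. T((i, p i - 1) := psize p)) (standard_tableaux (remove_box p i))"
    proof (rule inj_onI)
      fix S T assume "S \<in> standard_tableaux (remove_box p i)" "T \<in> standard_tableaux (remove_box p i)"
        and eq: "S((i, p i - 1) := psize p) = T((i, p i - 1) := psize p)"
      then show "S = T" using undef[OF i]
        by (metis fun_upd_triv fun_upd_upd)
    qed
    then show ?thesis by (simp add: A_def card_image num_syt_def)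
  qed
  ultimately show ?thesis by (simp add: num_syt_def)
qed

lemma psize_eq_0D: "p \<in> partitions \<Longrightarrow> psize p = 0 \<Longrightarrow> p = (\<lambda>_. 0)"
  using partition_supported_below_size by fastforce

lemma num_syt_empty: "num_syt (\<lambda>_. 0) = 1"
proof -
  have "standard_tableaux (\<lambda>_. 0) = {\<lambda>_. undefined}"
    by (auto simp: standard_tableaux_def diagram_def psize_def bij_betw_def)
  then show ?thesis by (simp add: num_syt_def)
qed

section \<open>Normalised tableau counts and Frobenius' formula\<close>

text \<open>By the hook length formula this is the reciprocal of the product of the hook
  lengths.\<close>

definition syt_ratio :: "(nat \<Rightarrow> nat) \<Rightarrow> real" where
  "syt_ratio p = real (num_syt p) / fact (psize p)"

lemma syt_ratio_nonneg: "0 \<le> syt_ratio p"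
  by (simp add: syt_ratio_def)

lemma syt_ratio_rec:
  assumes p: "p \<in> partitions" and N: "psize p > 0"
  shows "real (psize p) * syt_ratio p = (\<Sum>i\<in>corners p. syt_ratio (remove_box p i))"
proof -
  obtain n where n: "psize p = Suc n" using N by (cases "psize p") auto
  have "syt_ratio (remove_box p i) = real (num_syt (remove_box p i)) / fact n" if "i \<in> corners p" for i
    using psize_remove_box[OF p that] n by (simp add: syt_ratio_def)
  then have "(\<Sum>i\<in>corners p. syt_ratio (remove_box p i)) = real (num_syt p) / fact n"
    using num_syt_rec[OF p N] by (simp add: sum_divide_distrib)
  then show ?thesis using n by (simp add: syt_ratio_def del: of_nat_Suc)
qed

text \<open>Induction on the number of boxes with \<open>M\<close> held fixed, so that
  \<open>V M\<close> and \<open>W M\<close> can be compared before and after removing a box.\<close>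

lemma partition_induct [consumes 1, case_names empty step]:
  assumes "p \<in> \<Omega> M" and "P (\<lambda>_. 0)"
    and step: "\<And>p. p \<in> \<Omega> M \<Longrightarrow> psize p > 0 \<Longrightarrow> (\<And>i. i \<in> corners p \<Longrightarrow> P (remove_box p i)) \<Longrightarrow> P p"
  shows "P p"
  using assms(1)
proof (induction "psize p" arbitrary: p)
  case 0
  then have "p = (\<lambda>_. 0)" by (intro psize_eq_0D) (auto simp: \<Omega>_def)
  then show ?case using assms(2) by simp
next
  case (Suc n)
  have p: "p \<in> partitions" using Suc by (simp add: \<Omega>_def)
  show ?case
  proof (rule step)
    fix i assume i: "i \<in> corners p"
    show "P (remove_box p i)"
      using psize_remove_box[OF p i] Suc.hyps(2) remove_box_Omega[OF Suc.prems i] by (intro Suc.hyps(1)) simp_all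
  qed (use Suc in auto)
qed

text \<open>Only the factors involving \<open>x k\<close> change, and each acquires the same
  quotient \<open>1 - t / (x k - x j)\<close> whether \<open>k\<close> is the first or the second
  index of the pair.\<close>

lemma prod_less_pairs_shift:
  fixes x :: "nat \<Rightarrow> 'a :: field"
  assumes inj: "inj_on x {..<M}" and k: "k < M"
  shows "(\<Prod>(i, j)\<in>{(i, j). i < j \<and> j < M}. (x(k := x k - t)) i - (x(k := x k - t)) j) =
         (\<Prod>(i, j)\<in>{(i, j). i < j \<and> j < M}. x i - x j) * (\<Prod>j\<in>{..<M} - {k}. 1 - t / (x k - x j))"
proof -
  let ?P = "{(i, j). i < j \<and> j < M}"
  have fin: "finite ?P" by (rule finite_subset[of _ "{..<M} \<times> {..<M}"]) auto
  define s where "s j = 1 - t / (x k - x j)" for j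
  \<comment> \<open>\<open>q\<close> is the correction attached to a pair, and \<open>h\<close>
    turns an index \<open>j\<close> into the ordered pair that it forms with
    \<open>k\<close>.\<close>
  define q where "q = (\<lambda>(i, j). if i = k then s j else if j = k then s i else 1)"
  define h where "h j = (min j k, max j k)" for j
  have "(x(k := x k - t)) i - (x(k := x k - t)) j = (x i - x j) * q (i, j)" if "i < j" "j < M" for i j
  proof -
    have ne: "x i - x j \<noteq> 0" "x j - x i \<noteq> 0" using inj_onD[OF inj, of i j] that by auto
    have "(x i - x j) * (t / (x i - x j)) = t" "(x i - x j) * (t / (x j - x i)) = - t"
      using ne by (simp_all add: divide_simps) (simp add: algebra_simps)
    then show ?thesis using that by (auto simp: q_def s_def right_diff_distrib)
  qed
  then have "(\<Prod>(i, j)\<in>?P. (x(k := x k - t)) i - (x(k := x k - t)) j) = (\<Prod>(i, j)\<in>?P. (x i - x j) * q (i, j))"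
    by (intro prod.cong) auto
  also have "\<dots> = (\<Prod>(i, j)\<in>?P. x i - x j) * prod q ?P"
    by (simp add: prod.distrib case_prod_unfold)
  also have "prod q ?P = prod q (h ` ({..<M} - {k}))"
  proof (rule prod.mono_neutral_right[OF fin])
    show "h ` ({..<M} - {k}) \<subseteq> ?P" using k by (auto simp: h_def)
    show "\<forall>ij\<in>?P - h ` ({..<M} - {k}). q ij = 1"
    proof
      fix ij assume ij: "ij \<in> ?P - h ` ({..<M} - {k})"
      obtain i j where e: "ij = (i, j)" by (cases ij)
      have "i \<noteq> k" using ij e by (auto simp: h_def image_iff min_def max_def dest!: spec[of _ j] bspec[of _ _ j])
      moreover have "j \<noteq> k" using ij e by (auto simp: h_def image_iff min_def max_def dest!: spec[of _ i] bspec[of _ _ i])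
      ultimately show "q ij = 1" by (simp add: q_def e)
    qed
  qed
  also have "\<dots> = (\<Prod>j\<in>{..<M} - {k}. q (h j))"
    by (rule prod.reindex[unfolded o_def]) (auto simp: inj_on_def h_def min_def max_def split: if_splits)
  also have "\<dots> = (\<Prod>j\<in>{..<M} - {k}. s j)"
    by (intro prod.cong) (auto simp: q_def h_def min_def max_def)
  finally show ?thesis by (simp add: s_def)
qed

text \<open>For fixed \<open>i\<close> the differences \<open>j - i\<close> multiply to
  \<open>(M - 1 - i)!\<close>, which cancels the corresponding factor of \<open>W\<close>.\<close>

lemma V_W_empty: "V M (\<lambda>_. 0) * W M (\<lambda>_. 0) = 1"
proof -
  have "{(i, j). i < j \<and> j < M} = (SIGMA i:{..<M}. {i<..<M})" by auto
  then have "V M (\<lambda>_. 0) = (\<Prod>i<M. \<Prod>j\<in>{i<..<M}. real j - real i)"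
    by (simp add: V_def prod.Sigma)
  also have "\<dots> = (\<Prod>i<M. fact (M - Suc i))"
  proof (rule prod.cong)
    fix i assume "i \<in> {..<M}"
    then have e: "{i<..<M} = (\<lambda>d. i + d) ` {1..M - Suc i}"
      by (force simp: image_iff intro: rev_bexI[of "_ - i"])
    show "(\<Prod>j\<in>{i<..<M}. real j - real i) = fact (M - Suc i)"
      unfolding e by (subst prod.reindex) (auto simp: fact_prod)
  qed simp
  finally show ?thesis by (simp add: W_def prod_dividef)
qed

text \<open>\<open>V M p * W M p\<close> obeys the same recursion as \<open>syt_ratio\<close> and
  has the same value at the empty partition.\<close>

lemma frobenius_formula:
  assumes "p \<in> \<Omega> M"
  shows "syt_ratio p = V M p * W M p"
  using assms
proof (induction rule: partition_induct)
  case empty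
  then show ?case using V_W_empty num_syt_empty by (simp add: syt_ratio_def psize_def)
next
  case (step p)
  have P: "p \<in> partitions" using step by (simp add: \<Omega>_def)
  \<comment> \<open>The shifted parts decrease strictly and \<open>V M p\<close> is their
    Vandermonde product. Removing a box from row \<open>i\<close> lowers \<open>x i\<close> by one,
    which multiplies \<open>V\<close> by \<open>r i\<close> and \<open>W\<close> by
    \<open>x i\<close>.\<close>
  define x where "x i = real (p i) + (real M - 1 - real i)" for i
  define r where "r i = (\<Prod>j\<in>{..<M} - {i}. 1 - 1 / (x i - x j))" for i
  have less: "x j < x i" if "i < j" for i j
    using partitions_antimonoD[OF P, of i j] that by (simp add: x_def)
  have inj: "inj_on x {..<M}"
    by (rule linorder_inj_onI) (use less in force)+
  have corner: "V M (remove_box p i) * W M (remove_box p i) = V M p * W M p * (x i * r i)"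
    if i: "i \<in> corners p" for i
  proof -
    have iM: "i < M" using i corners_subset[OF step(1)] by auto
    have "V M (remove_box p i) =
        (\<Prod>(a, b)\<in>{(a, b). a < b \<and> b < M}. (x(i := x i - 1)) a - (x(i := x i - 1)) b)"
      unfolding V_def using corner_pos[OF i]
      by (intro prod.cong) (auto simp: remove_box_def x_def of_nat_diff)
    also have "\<dots> = V M p * r i"
      unfolding prod_less_pairs_shift[OF inj iM] by (auto simp: V_def r_def x_def algebra_simps intro!: prod.cong)
    finally have 1: "V M (remove_box p i) = V M p * r i" .
    have fact: "fact (p i + (M - Suc i)) = x i * fact (p i - 1 + (M - Suc i))"
      using corner_pos[OF i] iM by (cases "p i") (auto simp: x_def of_nat_diff)
    have xi: "x i \<noteq> 0" using corner_pos[OF i] iM by (simp add: x_def)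
    have W: "W M q = 1 / fact (q i + (M - Suc i)) * (\<Prod>j\<in>{..<M} - {i}. 1 / fact (q j + (M - Suc j)))" for q
      using iM by (simp add: W_def prod.remove)
    have "W M (remove_box p i) = W M p * x i"
      unfolding W using xi by (simp add: remove_box_def fact)
    then show ?thesis using 1 by simp
  qed
  \<comment> \<open>Equal consecutive parts give \<open>x i - x (Suc i) = 1\<close>, hence a zero
    factor in \<open>r i\<close>; in the last row a non-corner has \<open>p i = 0\<close>, hence
    \<open>x i = 0\<close>. So the sum over the corners extends to all rows.\<close>
  have noncorner: "x i * r i = 0" if "i \<in> {..<M} - corners p" for i
  proof -
    have eq: "p (Suc i) = p i" using that partitions_antimonoD[OF P, of i "Suc i"] by (auto simp: corners_def)
    show ?thesis
    proof (cases "Suc i < M")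
      case True
      have "x i - x (Suc i) = 1" using eq by (simp add: x_def)
      then have "r i = 0" using True by (auto simp: r_def prod_zero_iff intro!: bexI[of _ "Suc i"])
      then show ?thesis by simp
    next
      case False
      then have "M = Suc i" using that by auto
      then show ?thesis using step(1) eq by (auto simp: \<Omega>_def x_def)
    qed
  qed
  have "(\<Sum>i\<in>corners p. x i * r i) = (\<Sum>i<M. x i * r i)"
    using noncorner corners_subset[OF step(1)] by (intro sum.mono_neutral_left) auto
  also have "\<dots> = (\<Sum>i<M. x i) - real (M choose 2)"
    using sum_shift_products(2)[OF _ inj, of 1] by (simp add: r_def)
  \<comment> \<open>The shifts add up to \<open>M choose 2\<close>, exactly what is subtracted, so
    only the number of boxes remains.\<close>
  also have "(\<Sum>i<M. x i) = real (psize p) + (\<Sum>i<M. real (M - Suc i))"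
    unfolding psize_eq_sum[OF step(1)] by (simp add: x_def sum.distrib of_nat_diff Suc_le_eq diff_diff_eq)
  also have "(\<Sum>i<M. real (M - Suc i)) = real (\<Sum>i<M. i)"
    by (subst sum.nat_diff_reindex) simp
  also have "(\<Sum>i<M. i) = M choose 2"
    by (induction M) (simp_all add: numeral_2_eq_2)
  finally have N: "(\<Sum>i\<in>corners p. x i * r i) = real (psize p)" by simp
  have "real (psize p) * syt_ratio p = (\<Sum>i\<in>corners p. syt_ratio (remove_box p i))"
    using syt_ratio_rec[OF P step(2)] .
  also have "\<dots> = (\<Sum>i\<in>corners p. V M p * W M p * (x i * r i))"
    using step(3) corner by simp
  also have "\<dots> = real (psize p) * (V M p * W M p)"
    unfolding sum_distrib_left[symmetric] N by simp
  finally show ?case using step(2) by simp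
qed

section \<open>Comparison of the two masses\<close>

lemma poissonized_plancherel_mass_eq:
  assumes "p \<in> partitions"
  shows "poissonized_plancherel_mass \<alpha> p = exp (- \<alpha>) * \<alpha> ^ psize p * (syt_ratio p)\<^sup>2"
proof -
  \<comment> \<open>Only the summand at the size of \<open>p\<close> is nonzero, and its two
    factorials complete the square of \<open>syt_ratio p\<close>.\<close>
  have "(\<Sum>N. plancherel_mass N p * (\<alpha> ^ N / fact N)) =
        (\<Sum>N\<in>{psize p}. plancherel_mass N p * (\<alpha> ^ N / fact N))"
    by (rule suminf_finite) (auto simp: plancherel_mass_def partitions_of_def)
  then show ?thesis using assms
    by (simp add: poissonized_plancherel_mass_def plancherel_mass_def partitions_of_def syt_ratio_def
        power2_eq_square)
qed

text \<open>The number \<open>j - i\<close> is the content of the box \<open>(i, j)\<close>. Rows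
  from \<open>M\<close> on are left out, which changes nothing on \<open>\<Omega> M\<close>.\<close>

definition content_product :: "nat \<Rightarrow> (nat \<Rightarrow> nat) \<Rightarrow> real" where
  "content_product M p = (\<Prod>i<M. \<Prod>j<p i. 1 + (real j - real i) / real M)"

text \<open>Frobenius' formula turns \<open>(V M p)^2 * W M p\<close> into
  \<open>(syt_ratio p)^2 / W M p\<close>. In row \<open>i\<close> the quotient of
  \<open>(p i + M - 1 - i)!\<close> by \<open>(M - 1 - i)!\<close> is the product of
  \<open>M + j - i\<close> over \<open>j < p i\<close>, and the powers of \<open>1 / M\<close>
  normalise each factor to \<open>1 + (j - i) / M\<close>.\<close>

lemma charlier_mass_eq:
  assumes p: "p \<in> \<Omega> M" and M: "M \<ge> 1"
  shows "charlier_mass \<alpha> M p =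
    exp (- \<alpha>) * \<alpha> ^ psize p * (syt_ratio p)\<^sup>2 * content_product M p"
proof -
  have "{..<M} = insert 0 {1..M - 1}" using M by auto
  then have "(\<Prod>j = 1..M - 1. 1 / fact j) = (\<Prod>j<M. 1 / fact j :: real)" by simp
  also have "\<dots> = (\<Prod>i<M. 1 / fact (M - Suc i))"
    by (rule prod.nat_diff_reindex[symmetric])
  finally have 1: "(\<Prod>j = 1..M - 1. 1 / fact j) = (\<Prod>i<M. 1 / fact (M - Suc i) :: real)" .
  have W0: "W M p \<noteq> 0" by (simp add: W_def)
  have "1 / fact (M - Suc i) * (1 / real M) ^ p i * fact (p i + (M - Suc i)) =
      (\<Prod>j<p i. 1 + (real j - real i) / real M)" if "i < M" for i
  proof -
    have "fact (n + (M - Suc i)) = fact (M - Suc i) * (\<Prod>j<n. real M + real j - real i)" for n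
      using that by (induction n) (auto simp: of_nat_diff algebra_simps)
    moreover have "(\<Prod>j<n. 1 + (real j - real i) / real M) =
        (\<Prod>j<n. real M + real j - real i) * (1 / real M) ^ n" for n
      using M by (induction n) (auto simp: field_simps)
    ultimately show ?thesis by simp
  qed
  then have "content_product M p =
      (\<Prod>i<M. 1 / fact (M - Suc i) * (1 / real M) ^ p i * fact (p i + (M - Suc i)))"
    by (simp add: content_product_def)
  also have "\<dots> = (\<Prod>i<M. 1 / fact (M - Suc i)) * (1 / real M) ^ psize p * (1 / W M p)"
    unfolding prod.distrib psize_eq_sum[OF p] power_sum W_def by (simp add: prod_dividef)
  finally have c: "content_product M p =
      (\<Prod>i<M. 1 / fact (M - Suc i)) * (1 / real M) ^ psize p * (1 / W M p)" .
  have e: "(\<Prod>i<M. (\<alpha> / real M) ^ p i * exp (- \<alpha> / real M)) = (\<alpha> / real M) ^ psize p * exp (- \<alpha>)"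
    using M unfolding prod.distrib psize_eq_sum[OF p] power_sum
    by (simp add: exp_of_nat_mult[symmetric])
  show ?thesis
    unfolding charlier_mass_def 1 c e frobenius_formula[OF p] using W0
    by (simp add: power2_eq_square power_divide)
qed

section \<open>Decay of \<open>syt_ratio\<close> and the number of partitions\<close>

text \<open>Multiplying the recursion by \<open>wt p\<close> and using induction bounds
  \<open>psize p * (syt_ratio p * wt p)\<close> by the sum of the \<open>c p i\<close>, hence by
  \<open>psize p\<close>. The row bound and the column bound are both instances.\<close>

lemma syt_ratio_weight_le_1:
  fixes wt :: "(nat \<Rightarrow> nat) \<Rightarrow> real"
  assumes "p \<in> \<Omega> M" and "wt (\<lambda>_. 0) = 1"
    and wt: "\<And>p i. p \<in> \<Omega> M \<Longrightarrow> i \<in> corners p \<Longrightarrow> wt p = real (c p i) * wt (remove_box p i)"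
    and c: "\<And>p. p \<in> \<Omega> M \<Longrightarrow> (\<Sum>i\<in>corners p. c p i) \<le> psize p"
  shows "syt_ratio p * wt p \<le> 1"
  using assms(1)
proof (induction rule: partition_induct)
  case empty
  then show ?case using assms(2) num_syt_empty by (simp add: syt_ratio_def psize_def)
next
  case (step p)
  have P: "p \<in> partitions" using step by (simp add: \<Omega>_def)
  have "real (psize p) * (syt_ratio p * wt p) = (\<Sum>i\<in>corners p. syt_ratio (remove_box p i)) * wt p"
    using syt_ratio_rec[OF P step(2)] by simp
  also have "\<dots> = (\<Sum>i\<in>corners p. real (c p i) * (syt_ratio (remove_box p i) * wt (remove_box p i)))"
    unfolding sum_distrib_right by (intro sum.cong refl) (simp add: wt[OF step(1)])
  also have "\<dots> \<le> (\<Sum>i\<in>corners p. real (c p i) * 1)"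
    using step(3) by (intro sum_mono mult_left_mono) auto
  also have "\<dots> \<le> real (psize p) * 1"
    using c[OF step(1)] unfolding mult_1_right of_nat_sum[symmetric] of_nat_le_iff .
  finally show ?case by (rule mult_left_le_imp_le) (use step(2) in simp)
qed

text \<open>There are \<open>p i - p (Suc i)\<close> columns of height exactly \<open>Suc i\<close>,
  and the \<open>p m\<close> columns higher than \<open>m\<close> have \<open>m\<close> boxes each
  in the first \<open>m\<close> rows.\<close>

lemma sum_parts_by_columns:
  assumes "p \<in> partitions"
  shows "(\<Sum>i<m. Suc i * (p i - p (Suc i))) + m * p m = (\<Sum>i<m. p i)"
proof (induction m)
  case (Suc m)
  have "p (Suc m) \<le> p m" using partitions_antimonoD[OF assms] by simp
  then obtain d where "p m = p (Suc m) + d" using le_Suc_ex by blast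
  then show ?case using Suc by (simp add: algebra_simps)
qed simp

text \<open>Removing the last box of row \<open>i\<close> divides the weight by the row length
  \<open>p i\<close>, and corners lie in different rows.\<close>

lemma syt_ratio_rows: "p \<in> \<Omega> M \<Longrightarrow> syt_ratio p * (\<Prod>i<M. fact (p i)) \<le> 1"
proof (rule syt_ratio_weight_le_1[where wt = "\<lambda>p. \<Prod>i<M. fact (p i)" and c = "\<lambda>p i. p i"])
  fix p i assume p: "p \<in> \<Omega> M" and i: "i \<in> corners p"
  have iM: "i < M" using i corners_subset[OF p] by auto
  have "(fact (p i) :: real) = real (p i) * fact (p i - 1)"
    using corner_pos[OF i] by (simp add: fact_reduce)
  then show "(\<Prod>i<M. fact (p i)) = real (p i) * (\<Prod>j<M. fact (remove_box p i j))"
    using iM by (simp add: prod.remove remove_box_def)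
next
  fix p assume p: "p \<in> \<Omega> M"
  show "(\<Sum>i\<in>corners p. p i) \<le> psize p"
    unfolding psize_eq_sum[OF p] using corners_subset[OF p] by (intro sum_mono2) auto
qed simp_all

text \<open>Removing a corner in row \<open>i\<close> divides the weight by \<open>i + 1\<close>,
  the height of its column, and corners lie in different columns.\<close>

lemma syt_ratio_columns: "p \<in> \<Omega> M \<Longrightarrow> syt_ratio p * (\<Prod>i<M. real (Suc i) ^ p i) \<le> 1"
proof (rule syt_ratio_weight_le_1[where wt = "\<lambda>p. \<Prod>i<M. real (Suc i) ^ p i" and c = "\<lambda>p i. Suc i"])
  fix p i assume p: "p \<in> \<Omega> M" and i: "i \<in> corners p"
  have iM: "i < M" using i corners_subset[OF p] by auto
  have "real (Suc i) ^ p i = real (Suc i) * real (Suc i) ^ (p i - 1)"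
    using corner_pos[OF i] by (cases "p i") simp_all
  then show "(\<Prod>i<M. real (Suc i) ^ p i) = real (Suc i) * (\<Prod>j<M. real (Suc j) ^ remove_box p i j)"
    using iM by (simp add: prod.remove remove_box_def del: of_nat_Suc)
next
  fix p assume p: "p \<in> \<Omega> M"
  \<comment> \<open>At a corner at least one column has height exactly \<open>Suc i\<close>.\<close>
  have "(\<Sum>i\<in>corners p. Suc i) \<le> (\<Sum>i\<in>corners p. Suc i * (p i - p (Suc i)))"
    by (intro sum_mono) (simp add: corners_def del: mult_Suc)
  also have "\<dots> \<le> (\<Sum>i<M. Suc i * (p i - p (Suc i)))"
    using corners_subset[OF p] by (intro sum_mono2) auto
  also have "\<dots> \<le> psize p"
    unfolding psize_eq_sum[OF p] using sum_parts_by_columns[of p M] p by (simp add: \<Omega>_def)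
  finally show "(\<Sum>i\<in>corners p. Suc i) \<le> psize p" .
qed simp_all

(* All but at most K^2 boxes (i, j) satisfy (i + 1) (j + 1) >= K. *)
lemma rows_columns_superexponential:
  assumes p: "p \<in> \<Omega> M" and K: "K \<ge> 1"
  shows "real K ^ psize p \<le>
    real K ^ (K * K) * ((\<Prod>i<M. fact (p i)) * (\<Prod>i<M. real (Suc i) ^ p i))"
proof -
  let ?S = "SIGMA i:{..<M}. {..<p i}" and ?B = "{..<K} \<times> {..<K}"
  have fin: "finite ?S" by simp
  have cardS: "card ?S = psize p" by (simp add: psize_eq_sum[OF p])
  have RC: "(\<Prod>(i, j)\<in>?S. real (Suc i) * real (Suc j)) =
      (\<Prod>i<M. fact (p i)) * (\<Prod>i<M. real (Suc i) ^ p i)"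
    by (simp add: prod.Sigma[symmetric] prod.distrib fact_prod_Suc atLeast0LessThan mult.commute
        del: of_nat_Suc)
  have "real K ^ psize p = (\<Prod>b\<in>?S. real K)" by (simp add: cardS)
  also have "\<dots> \<le> (\<Prod>b\<in>?S. (if b \<in> ?B then real K else 1) * (case b of (i, j) \<Rightarrow> real (Suc i) * real (Suc j)))"
  proof (rule prod_mono, clarify, intro conjI)
    fix i j
    show "real K \<le> (if (i, j) \<in> ?B then real K else 1) * (real (Suc i) * real (Suc j))"
    proof (cases "(i, j) \<in> ?B")
      case True
      have "1 * 1 \<le> real (Suc i) * real (Suc j)" by (intro mult_mono) auto
      then have "real K * 1 \<le> real K * (real (Suc i) * real (Suc j))" by (intro mult_left_mono) simp_all
      then show ?thesis using True by simp
    next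
      case False
      then have "K \<le> Suc i \<or> K \<le> Suc j" by auto
      then have "K \<le> Suc i * Suc j" by (elim disjE) (auto intro: order_trans)
      then show ?thesis using False unfolding of_nat_mult[symmetric] by (simp del: mult_Suc mult_Suc_right of_nat_mult)
    qed
  qed simp
  also have "\<dots> = (\<Prod>b\<in>?S. if b \<in> ?B then real K else 1) * (\<Prod>(i, j)\<in>?S. real (Suc i) * real (Suc j))"
    by (rule prod.distrib)
  also have "(\<Prod>b\<in>?S. if b \<in> ?B then real K else 1) = real K ^ card (?S \<inter> ?B)"
    using fin by (simp add: prod.inter_restrict[symmetric])
  also have "real K ^ card (?S \<inter> ?B) \<le> real K ^ (K * K)"
    using K card_mono[of ?B "?S \<inter> ?B"] by (intro power_increasing) (auto simp: card_cartesian_product)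
  finally show ?thesis
    unfolding RC by (simp add: mult_right_mono prod_nonneg)
qed

text \<open>After squaring, both bounds apply at once: \<open>F^4 * R^3 * C\<close> equals
  \<open>(F * R)^3 * (F * C)\<close>, which is at most 1.\<close>

lemma syt_ratio_superexponential:
  assumes p: "p \<in> \<Omega> M" and k: "k \<ge> 1"
  shows "(syt_ratio p)\<^sup>2 * (\<Prod>i<M. fact (p i)) * real k ^ psize p \<le> real k ^ (k\<^sup>2 * k\<^sup>2)"
proof -
  define R C F where "R = (\<Prod>i<M. fact (p i) :: real)" and "C = (\<Prod>i<M. real (Suc i) ^ p i)"
    and "F = syt_ratio p"
  have nn: "0 \<le> R" "0 \<le> C" "0 \<le> F"
    by (simp_all add: R_def C_def F_def prod_nonneg syt_ratio_nonneg)
  have FR: "F * R \<le> 1" and FC: "F * C \<le> 1"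
    using syt_ratio_rows[OF p] syt_ratio_columns[OF p] by (simp_all add: R_def C_def F_def)
  have "(F\<^sup>2 * R * real k ^ psize p)\<^sup>2 = (F * R)\<^sup>2 * F\<^sup>2 * (real (k\<^sup>2) ^ psize p)"
    by (simp add: power_mult_distrib power_mult[symmetric] mult.commute power2_eq_square mult.assoc
        flip: power_mult)
  \<comment> \<open>Squaring has turned the base \<open>k\<close> into \<open>k^2\<close>, hence the
    choice \<open>K = k^2\<close>.\<close>
  also have "\<dots> \<le> (F * R)\<^sup>2 * F\<^sup>2 * (real (k\<^sup>2) ^ (k\<^sup>2 * k\<^sup>2) * (R * C))"
    using rows_columns_superexponential[OF p, of "k\<^sup>2"] k
    by (intro mult_left_mono) (auto simp: R_def C_def)
  also have "\<dots> = (F * R) ^ 3 * (F * C) * (real k ^ (k\<^sup>2 * k\<^sup>2))\<^sup>2"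
    by (simp add: power2_eq_square power3_eq_cube power_mult_distrib)
  also have "\<dots> \<le> 1 * 1 * (real k ^ (k\<^sup>2 * k\<^sup>2))\<^sup>2"
    using nn FR FC by (intro mult_right_mono mult_mono power_le_one) auto
  finally have "(F\<^sup>2 * R * real k ^ psize p)\<^sup>2 \<le> (real k ^ (k\<^sup>2 * k\<^sup>2))\<^sup>2" by simp
  then show ?thesis
    unfolding R_def[symmetric] F_def[symmetric] by (rule power2_le_imp_le) simp
qed

(* The Maya diagram {p i + (N - 1 - i) | i < N} determines p. *)
lemma card_partitions_of: "finite (partitions_of N)" "card (partitions_of N) \<le> 4 ^ N"
proof -
  \<comment> \<open>Read from the last row upwards the entries increase strictly, so the set of
    entries determines their list.\<close>
  define x where "x p i = p (N - Suc i) + i" for p :: "nat \<Rightarrow> nat" and i :: nat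
  have inj: "inj_on (\<lambda>p. x p ` {..<N}) (partitions_of N)"
  proof (rule inj_onI)
    fix p q assume p: "p \<in> partitions_of N" and q: "q \<in> partitions_of N"
      and eq: "x p ` {..<N} = x q ` {..<N}"
    have sorted: "sorted_wrt (<) (map (x p) [0..<N])" if "p \<in> partitions_of N" for p
      unfolding sorted_wrt_map
    proof (rule sorted_wrt_mono_rel[OF _ sorted_wrt_upt])
      fix i j :: nat assume "i < j" "j \<in> set [0..<N]"
      then show "x p i < x p j"
        using partitions_antimonoD[of p "N - Suc j" "N - Suc i"] that
        by (simp add: x_def partitions_of_def diff_le_mono2)
    qed
    have "map (x p) [0..<N] = map (x q) [0..<N]"
      using sorted[OF p] sorted[OF q] eq
      by (intro sorted_distinct_set_unique) (auto simp: strict_sorted_iff atLeast0LessThan)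
    then have xeq: "x p i = x q i" if "i < N" for i
      using that by (auto simp: map_eq_conv)
    show "p = q"
    proof
      fix i
      show "p i = q i"
      proof (cases "i < N")
        case True
        then show ?thesis using xeq[of "N - Suc i"] by (auto simp: x_def)
      next
        case False
        then have "p i = 0" "q i = 0"
          using p q partition_supported_below_size[of p i] partition_supported_below_size[of q i]
          by (auto simp: partitions_of_def)
        then show ?thesis by simp
      qed
    qed
  qed
  \<comment> \<open>Every part is at most \<open>N\<close>, so the entries stay below
    \<open>2 * N\<close>; this range has \<open>4 ^ N\<close> subsets.\<close>
  have sub: "(\<lambda>p. x p ` {..<N}) ` partitions_of N \<subseteq> Pow {..<2 * N}"
  proof (intro image_subsetI PowI)
    fix p i assume p: "p \<in> partitions_of N" and "i \<in> {..<N}"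
    then have i: "i < N" by simp
    have "p \<in> \<Omega> N" using p by (intro partition_in_Omega) (auto simp: partitions_of_def)
    then have "(\<Sum>i<N. p i) = N" using p psize_eq_sum[of p N] by (simp add: partitions_of_def)
    then have "p (N - Suc i) \<le> N"
      using member_le_sum[of "N - Suc i" "{..<N}" p] i by simp
    then show "x p i \<in> {..<2 * N}" using i by (simp add: x_def)
  qed
  show "finite (partitions_of N)"
    using finite_imageD[OF finite_subset[OF sub] inj] by simp
  have "card (partitions_of N) \<le> card (Pow {..<2 * N})"
    using card_inj_on_le[OF inj sub] by simp
  then show "card (partitions_of N) \<le> 4 ^ N"
    by (simp add: card_Pow power_mult)
qed

text \<open>With base 1/8 the at most \<open>4 ^ N\<close> partitions of size \<open>N\<close>
  contribute at most \<open>(1 / 2) ^ N\<close>, so every finite sum is at most 2.\<close>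

lemma summable_partitions: "(\<lambda>p. (1 / 8 :: real) ^ psize p) summable_on partitions"
proof (rule nonneg_bdd_above_summable_on)
  show "bdd_above (sum (\<lambda>p. (1 / 8 :: real) ^ psize p) ` {F. F \<subseteq> partitions \<and> finite F})"
  proof (rule bdd_aboveI2)
    fix F assume F: "F \<in> {F. F \<subseteq> partitions \<and> finite F}"
    define n where "n = Max (insert 0 (psize ` F))"
    have "F \<subseteq> (\<Union>N\<le>n. partitions_of N)"
      using F by (auto simp: partitions_of_def n_def)
    then have "(\<Sum>p\<in>F. (1 / 8 :: real) ^ psize p) \<le> (\<Sum>p\<in>(\<Union>N\<le>n. partitions_of N). (1 / 8) ^ psize p)"
      by (intro sum_mono2) (auto simp: card_partitions_of)
    also have "\<dots> = (\<Sum>N\<le>n. \<Sum>p\<in>partitions_of N. (1 / 8) ^ psize p)"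
      by (rule sum.UNION_disjoint) (auto simp: card_partitions_of(1), auto simp: partitions_of_def)
    also have "\<dots> = (\<Sum>N\<le>n. real (card (partitions_of N)) * (1 / 8) ^ N)"
      by (simp add: partitions_of_def)
    also have "\<dots> \<le> (\<Sum>N\<le>n. real (4 ^ N) * (1 / 8) ^ N)"
      using card_partitions_of(2) by (intro sum_mono mult_right_mono) (simp_all only: of_nat_le_iff, simp)
    also have "\<dots> = (\<Sum>N<Suc n. (1 / 2) ^ N)"
      by (simp add: power_mult_distrib[symmetric] lessThan_Suc_atMost)
    also have "\<dots> \<le> 2"
      by (subst geometric_sum) simp_all
    finally show "(\<Sum>p\<in>F. (1 / 8 :: real) ^ psize p) \<le> 2" .
  qed
qed simp

section \<open>Bounds and limit of the correction factor\<close>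

text \<open>A factor is nonnegative because \<open>i < M\<close>, and at most \<open>j + 1\<close>
  because \<open>M \<ge> 1\<close>; over a row the numbers \<open>j + 1\<close> multiply to
  \<open>fact (p i)\<close>.\<close>

lemma content_product_bounds:
  assumes M: "M \<ge> 1"
  shows "0 \<le> content_product M p" "content_product M p \<le> (\<Prod>i<M. fact (p i))"
proof -
  have b: "0 \<le> 1 + (real j - real i) / real M \<and> 1 + (real j - real i) / real M \<le> real (Suc j)"
    if "i < M" for i j
  proof
    show "0 \<le> 1 + (real j - real i) / real M" using that by (simp add: field_simps)
    have "(real j - real i) / real M \<le> real j / 1"
      using M by (intro frac_le) auto
    then show "1 + (real j - real i) / real M \<le> real (Suc j)" by simp
  qed
  show "0 \<le> content_product M p"
    unfolding content_product_def using b by (intro prod_nonneg) auto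
  show "content_product M p \<le> (\<Prod>i<M. fact (p i))"
    unfolding content_product_def fact_prod_Suc atLeast0LessThan of_nat_prod
    using b by (intro prod_mono conjI prod_nonneg) auto
qed

text \<open>Once \<open>M\<close> reaches the size of \<open>p\<close>, all further rows are empty,
  so the product runs over a fixed finite set of boxes.\<close>

lemma content_product_tendsto:
  assumes "p \<in> partitions"
  shows "(\<lambda>M. content_product M p) \<longlonglongrightarrow> 1"
proof -
  define n where "n = psize p"
  have "(\<lambda>M. \<Prod>i<n. \<Prod>j<p i. 1 + (real j - real i) / real M) \<longlonglongrightarrow> (\<Prod>i<n. \<Prod>j<p i. 1 + 0)"
    by (intro tendsto_intros lim_const_over_n)
  moreover have "\<forall>\<^sub>F M in sequentially.
      (\<Prod>i<n. \<Prod>j<p i. 1 + (real j - real i) / real M) = content_product M p"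
    using eventually_ge_at_top[of n]
  proof eventually_elim
    case (elim M)
    have "p i = 0" if "i \<notin> {..<n}" for i
      using partition_supported_below_size[OF assms, of i] that by (auto simp: n_def)
    then show ?case unfolding content_product_def
      using elim by (intro prod.mono_neutral_left) auto
  qed
  ultimately show ?thesis by (auto intro: Lim_transform_eventually)
qed

section \<open>Reduction of both expectations to sums over all partitions\<close>

text \<open>Nonnegativity keeps \<open>ennreal\<close> from truncating the weights to 0.\<close>

lemma point_measure_real_density:
  fixes g :: "'a \<Rightarrow> 'b::{banach, second_countable_topology}" and m :: "'a \<Rightarrow> real"
  assumes "\<And>x. x \<in> A \<Longrightarrow> 0 \<le> m x"
  shows "integrable (point_measure A (\<lambda>x. ennreal (m x))) g \<longleftrightarrow>
           integrable (count_space A) (\<lambda>x. m x *\<^sub>R g x)"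
    and "integral\<^sup>L (point_measure A (\<lambda>x. ennreal (m x))) g =
           (\<integral>x. m x *\<^sub>R g x \<partial>count_space A)"
  unfolding point_measure_def using assms
  by (simp_all add: integrable_density integral_density AE_count_space)

text \<open>This carries the integrals over the varying sets \<open>\<Omega> M\<close> to one common
  space, as dominated convergence requires.\<close>

lemma count_space_subset_indicator:
  fixes h :: "'a \<Rightarrow> 'b::{banach, second_countable_topology}"
  assumes "A \<subseteq> B"
  shows "integrable (count_space A) h \<longleftrightarrow> integrable (count_space B) (\<lambda>x. indicator A x *\<^sub>R h x)"
    and "integral\<^sup>L (count_space A) h = (\<integral>x. indicator A x *\<^sub>R h x \<partial>count_space B)"
  unfolding restrict_count_space_subset[OF assms, symmetric] using assms
  by (auto intro!: integrable_restrict_space integral_restrict_space)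

text \<open>At most \<open>L + psize p\<close> factors differ from 1. Taking the maximum of 1 and a
  bound for \<open>f\<close> as \<open>B\<close> also gives \<open>B \<ge> 1\<close>.\<close>

lemma generated_function_bound:
  assumes "g \<in> \<G> L"
  obtains B where "B \<ge> 1" "\<And>p. p \<in> partitions \<Longrightarrow> norm (g p) \<le> B ^ (L + psize p)"
proof -
  obtain f :: "int \<Rightarrow> complex" where bdd: "bounded (range f)" and one: "\<And>n. n < 0 \<Longrightarrow> f n = 1"
    and g: "\<And>p. p \<in> partitions \<Longrightarrow> g p = (\<Prod>i. f (int (p i) + int L - int (Suc i)))"
    using assms unfolding \<G>_def by auto
  obtain a where a: "\<And>n. norm (f n) \<le> a" using bdd by (auto simp: bounded_iff)
  have "norm (g p) \<le> max 1 a ^ (L + psize p)" if p: "p \<in> partitions" for p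
  proof -
    \<comment> \<open>From this index on the part is 0 and the argument \<open>L - Suc i\<close> is
      negative.\<close>
    have "f (int (p i) + int L - int (Suc i)) = 1" if "i \<notin> {..<L + psize p}" for i
      using that partition_supported_below_size[OF p, of i] by (cases "p i = 0") (auto intro!: one)
    then have "g p = (\<Prod>i<L + psize p. f (int (p i) + int L - int (Suc i)))"
      unfolding g[OF p] by (intro prodinf_finite) auto
    also have "norm \<dots> \<le> (\<Prod>i<L + psize p. max 1 a)"
      unfolding prod_norm[symmetric] using a by (intro prod_mono) (auto intro: max.coboundedI2)
    finally show ?thesis by simp
  qed
  then show ?thesis using that[of "max 1 a"] by simp
qed

section \<open>Dominated convergence\<close>

theorem theorem1p2:
  fixes L :: nat and \<alpha> :: real and g :: "(nat \<Rightarrow> nat) \<Rightarrow> complex"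
  assumes "\<alpha> > 0" and "g \<in> \<G> L"
  shows "integrable (poissonized_plancherel \<alpha>) g \<and>
         (\<forall>M\<ge>1. integrable (charlier \<alpha> M) g) \<and>
         (\<lambda>M. \<integral>p. g p \<partial>charlier \<alpha> M) \<longlonglongrightarrow> (\<integral>p. g p \<partial>poissonized_plancherel \<alpha>)"
proof -
  obtain B where B: "B \<ge> 1" "\<And>p. p \<in> partitions \<Longrightarrow> norm (g p) \<le> B ^ (L + psize p)"
    using generated_function_bound[OF assms(2)] by blast
  \<comment> \<open>The factor 8 leaves \<open>(1 / 8) ^ psize p\<close> for summability after
    \<open>syt_ratio_superexponential\<close> has absorbed \<open>real k ^ psize p\<close>.\<close>
  obtain k :: nat where k: "k \<ge> 1" "8 * \<alpha> * B \<le> real k"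
    using real_arch_simple[of "max 1 (8 * \<alpha> * B)"] by auto
  define D where "D = exp (- \<alpha>) * B ^ L * real k ^ (k\<^sup>2 * k\<^sup>2)"
  define w where "w p = D * (1 / 8) ^ psize p" for p
  \<comment> \<open>The Poissonized Plancherel mass times \<open>Q\<close>: on partitions
    \<open>Q = 1\<close> gives that mass itself, and on \<open>\<Omega> M\<close> with
    \<open>M \<ge> 1\<close> the content product gives the Charlier mass.\<close>
  define m where "m Q p = exp (- \<alpha>) * \<alpha> ^ psize p * (syt_ratio p)\<^sup>2 * Q" for Q p
  have m_nonneg: "0 \<le> m Q p" if "0 \<le> Q" for Q p
    using that assms(1) by (simp add: m_def)
  \<comment> \<open>The majorant \<open>w\<close> does not involve \<open>M\<close>, so it serves
    all Charlier ensembles at once.\<close>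
  have bound: "norm (m Q p *\<^sub>R g p) \<le> w p"
    if p: "p \<in> \<Omega> M" and Q: "0 \<le> Q" "Q \<le> (\<Prod>i<M. fact (p i))" for p M Q
  proof -
    let ?R = "\<Prod>i<M. fact (p i) :: real"
    have P: "p \<in> partitions" using p by (simp add: \<Omega>_def)
    have R: "0 \<le> ?R" by (simp add: prod_nonneg)
    have "norm (m Q p *\<^sub>R g p) \<le> m ?R p * B ^ (L + psize p)"
      using m_nonneg[OF Q(1)] m_nonneg[OF R] B(2)[OF P] Q assms(1)
      by (auto simp: m_def intro!: mult_mono mult_left_mono)
    also have "\<dots> = exp (- \<alpha>) * B ^ L * ((syt_ratio p)\<^sup>2 * ?R) * (\<alpha> * B) ^ psize p"
      by (simp add: m_def power_add power_mult_distrib)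
    also have "\<dots> \<le> exp (- \<alpha>) * B ^ L * ((syt_ratio p)\<^sup>2 * ?R) * (real k / 8) ^ psize p"
      using k(2) assms(1) B(1) R by (intro mult_left_mono power_mono mult_nonneg_nonneg) auto
    also have "\<dots> = exp (- \<alpha>) * B ^ L * ((syt_ratio p)\<^sup>2 * ?R * real k ^ psize p) * (1 / 8) ^ psize p"
      by (simp add: power_divide)
    also have "\<dots> \<le> w p"
      unfolding w_def D_def using syt_ratio_superexponential[OF p k(1)] B(1)
      by (intro mult_right_mono mult_left_mono) auto
    finally show ?thesis .
  qed
  have w: "integrable (count_space partitions) w"
  proof -
    have "(\<lambda>p. (1 / 8 :: real) ^ psize p) summable_on partitions" by (rule summable_partitions)
    then have "integrable (count_space partitions) (\<lambda>p. (1 / 8 :: real) ^ psize p)"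
      by (simp add: abs_summable_on_def[symmetric] abs_summable_equivalent[symmetric])
    then show ?thesis unfolding w_def by simp
  qed
  define F where "F p = m 1 p *\<^sub>R g p" for p
  define G where "G M p = indicator (\<Omega> M) p *\<^sub>R (m (content_product M p) p *\<^sub>R g p)" for M p
  have plancherel: "integrable (poissonized_plancherel \<alpha>) g \<longleftrightarrow> integrable (count_space partitions) F"
    "(\<integral>p. g p \<partial>poissonized_plancherel \<alpha>) = (\<integral>p. F p \<partial>count_space partitions)"
  proof -
    have eq: "poissonized_plancherel_mass \<alpha> p = m 1 p" if "p \<in> partitions" for p
      using that by (simp add: m_def poissonized_plancherel_mass_eq)
    have nn: "0 \<le> poissonized_plancherel_mass \<alpha> p" if "p \<in> partitions" for p
      unfolding eq[OF that] by (rule m_nonneg) simp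
    show "integrable (poissonized_plancherel \<alpha>) g \<longleftrightarrow> integrable (count_space partitions) F"
      unfolding poissonized_plancherel_def
      by (subst point_measure_real_density(1), erule nn, rule Bochner_Integration.integrable_cong)
        (simp_all add: F_def eq)
    show "(\<integral>p. g p \<partial>poissonized_plancherel \<alpha>) = (\<integral>p. F p \<partial>count_space partitions)"
      unfolding poissonized_plancherel_def
      by (subst point_measure_real_density(2), erule nn, rule Bochner_Integration.integral_cong)
        (simp_all add: F_def eq)
  qed
  have charlier: "integrable (charlier \<alpha> M) g \<longleftrightarrow> integrable (count_space partitions) (G M)"
    "(\<integral>p. g p \<partial>charlier \<alpha> M) = (\<integral>p. G M p \<partial>count_space partitions)" if M: "M \<ge> 1" for M
  proof -
    have eq: "charlier_mass \<alpha> M p = m (content_product M p) p" if "p \<in> \<Omega> M" for p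
      using charlier_mass_eq[OF that M] by (simp add: m_def)
    have nn: "0 \<le> charlier_mass \<alpha> M p" if "p \<in> \<Omega> M" for p
      unfolding eq[OF that] using content_product_bounds(1)[OF M] by (rule m_nonneg)
    have sub: "\<Omega> M \<subseteq> partitions" by (auto simp: \<Omega>_def)
    have *: "(\<lambda>p. indicator (\<Omega> M) p *\<^sub>R (charlier_mass \<alpha> M p *\<^sub>R g p)) = G M"
      by (auto simp: G_def eq split: split_indicator)
    show "integrable (charlier \<alpha> M) g \<longleftrightarrow> integrable (count_space partitions) (G M)"
      unfolding charlier_def
      by (subst point_measure_real_density(1), erule nn, subst count_space_subset_indicator(1)[OF sub])
        (simp only: *)
    show "(\<integral>p. g p \<partial>charlier \<alpha> M) = (\<integral>p. G M p \<partial>count_space partitions)"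
      unfolding charlier_def
      by (subst point_measure_real_density(2), erule nn, subst count_space_subset_indicator(2)[OF sub])
        (simp only: *)
  qed
  have domG: "norm (G M p) \<le> w p" if "M \<ge> 1" "p \<in> partitions" for M p
  proof (cases "p \<in> \<Omega> M")
    case True
    then show ?thesis using bound[OF True content_product_bounds[OF that(1)]] by (simp add: G_def)
  next
    case False
    then show ?thesis using B(1) by (simp add: G_def w_def D_def)
  qed
  have lim: "(\<lambda>M. G M p) \<longlonglongrightarrow> F p" if p: "p \<in> partitions" for p
  proof -
    have "(\<lambda>M. m (content_product M p) p *\<^sub>R g p) \<longlonglongrightarrow> F p"
      unfolding F_def m_def by (intro tendsto_intros content_product_tendsto p)
    \<comment> \<open>The indicator in \<open>G\<close> equals 1 as soon as \<open>M\<close> reaches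
      the size of \<open>p\<close>.\<close>
    moreover have "\<forall>\<^sub>F M in sequentially. m (content_product M p) p *\<^sub>R g p = G M p"
      using eventually_ge_at_top[of "psize p"]
      by eventually_elim (simp add: G_def partition_in_Omega[OF p])
    ultimately show ?thesis by (rule Lim_transform_eventually)
  qed
  \<comment> \<open>The index is shifted by one because the domination and the Charlier mass formula
    assume \<open>M \<ge> 1\<close>.\<close>
  have dom: "AE p in count_space partitions. (\<lambda>M. G (Suc M) p) \<longlonglongrightarrow> F p"
    "AE p in count_space partitions. norm (G (Suc M) p) \<le> w p" for M
    using lim domG by (auto simp: AE_count_space intro: LIMSEQ_Suc)
  note conv = _ _ w dom
  have "integrable (count_space partitions) F"
    by (rule integrable_dominated_convergence[OF conv]) simp_all
  moreover have "integrable (count_space partitions) (G M)" if "M \<ge> 1" for M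
    using w by (rule Bochner_Integration.integrable_bound) (use domG[OF that] in \<open>auto simp: AE_count_space intro: order_trans[OF _ abs_ge_self]\<close>)
  moreover have "(\<lambda>M. \<integral>p. G (Suc M) p \<partial>count_space partitions) \<longlonglongrightarrow> (\<integral>p. F p \<partial>count_space partitions)"
    by (rule integral_dominated_convergence[OF conv]) simp_all
  then have "(\<lambda>M. \<integral>p. g p \<partial>charlier \<alpha> (Suc M)) \<longlonglongrightarrow> (\<integral>p. g p \<partial>poissonized_plancherel \<alpha>)"
    using charlier(2) plancherel(2) by simp
  then have "(\<lambda>M. \<integral>p. g p \<partial>charlier \<alpha> M) \<longlonglongrightarrow> (\<integral>p. g p \<partial>poissonized_plancherel \<alpha>)"
    by (rule LIMSEQ_imp_Suc)
  ultimately show ?thesis using plancherel(1) charlier(1) by simp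
qed

end
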